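(* In $L(\mathfrak{sl}_2)^+$ define, for $i\geq 0$, $$A^{\uparrow\downarrow}_i=x\otimes(-t)^i,\qquad B^{\uparrow\downarrow}_i=(-y\otimes t-z\otimes(t-1))(-t)^i,\qquad \psi^{\uparrow\downarrow}_i=(x\otimes1-z\otimes(t-1))(-t)^{i-1}.$$ Then the Onsager Lie algebra $O$ has a basis $$A^{\uparrow\downarrow}_i,\qquad B^{\uparrow\downarrow}_i,\qquad \psi^{\uparrow\downarrow}_{i+1},\qquad i\in\mathbb{N},$$ where $A^{\uparrow\downarrow}_0=A$ and $B^{\uparrow\downarrow}_0=-B$. The Lie bracket acts on this basis as follows. For $i,j\in\mathbb{N}$, $$\begin{aligned} [A^{\uparrow\downarrow}_i,A^{\uparrow\downarrow}_j]&=0,\\ [B^{\uparrow\downarrow}_i,B^{\uparrow\downarrow}_j]&=0,\\ [\psi^{\uparrow\downarrow}_i,\psi^{\uparrow\downarrow}_j]&=0,\\ [\psi^{\uparrow\downarrow}_i,A^{\uparrow\downarrow}_j]&=2\psi^{\uparrow\downarrow}_{i+j}+2A^{\uparrow\downarrow}_{i+j},\\ [B^{\uparrow\downarrow}_i,\psi^{\uparrow\downarrow}_j]&=2B^{\uparrow\downarrow}_{i+j}+2\psi^{\uparrow\downarrow}_{i+j},\\ [A^{\uparrow\downarrow}_i,B^{\uparrow\downarrow}_j]&=2A^{\uparrow\downarrow}_{i+j}+2B^{\uparrow\downarrow}_{i+j}-4\psi^{\uparrow\downarrow}_{i+j+1}. \end{aligned}$$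
   Context: $\mathbb{F}$ is a field of characteristic zero; $\mathbb{N}=\{0,1,2,\ldots\}$; tensor products are over $\mathbb{F}$. $\mathfrak{sl}_2$ is the Lie algebra over $\mathbb{F}$ with basis $e,f,h$ and $[h,e]=2e$, $[h,f]=-2f$, $[e,f]=h$. Its equitable basis is $x=2e-h$, $y=-2f-h$, $z=h$, which satisfies $[x,y]=2x+2y$, $[y,z]=2y+2z$, $[z,x]=2z+2x$. Let $t$ be an indeterminate and $\mathcal{A}=\mathbb{F}[t,t^{-1},(t-1)^{-1}]$. The three-point $\mathfrak{sl}_2$ loop algebra $L(\mathfrak{sl}_2)^+$ is the vector space $\mathfrak{sl}_2\otimes\mathcal{A}$ with Lie bracket $[u\otimes a,v\otimes b]=[u,v]\otimes ab$. It is a right $\mathcal{A}$-module via $(u\otimes a)b=u\otimes ab$. The Onsager Lie algebra $O$ is the Lie algebra over $\mathbb{F}$ with generators $A,B$ and relations $[A,[A,[A,B]]]=4[A,B]$, $[B,[B,[B,A]]]=4[B,A]$. There is an injective Lie algebra homomorphism $O\to L(\mathfrak{sl}_2)^+$ with $A\mapsto x\otimes 1$, $B\mapsto y\otimes t+z\otimes(t-1)$, and $O$ is identified with its image; so $O$ is the Lie subalgebra of $L(\mathfrak{sl}_2)^+$ generated by $A=x\otimes1$ and $B=y\otimes t+z\otimes(t-1)$. The brackets in the claim are taken in $L(\mathfrak{sl}_2)^+$ (the element with index $0$ of the $\psi$ family does not lie in $O$). *)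

theory Defs
  imports
    "HOL-Computational_Algebra.Computational_Algebra"
    "HOL-Library.Poly_Mapping"
begin

subsection \<open>The Lie algebra sl2\<close>

text \<open>\<open>Sl2 a b c\<close> stands for \<open>a e + b f + c h\<close>.\<close>

datatype 'a sl2 = Sl2 (coord_e: 'a) (coord_f: 'a) (coord_h: 'a)

instantiation sl2 :: (ab_group_add) ab_group_add
begin

definition zero_sl2 :: "'a sl2" where
  "0 = Sl2 0 0 0"

definition plus_sl2 :: "'a sl2 \<Rightarrow> 'a sl2 \<Rightarrow> 'a sl2" where
  "u + v = Sl2 (coord_e u + coord_e v) (coord_f u + coord_f v) (coord_h u + coord_h v)"

definition uminus_sl2 :: "'a sl2 \<Rightarrow> 'a sl2" where
  "- u = Sl2 (- coord_e u) (- coord_f u) (- coord_h u)"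

definition minus_sl2 :: "'a sl2 \<Rightarrow> 'a sl2 \<Rightarrow> 'a sl2" where
  "u - v = Sl2 (coord_e u - coord_e v) (coord_f u - coord_f v) (coord_h u - coord_h v)"

instance
  by standard (simp_all add: zero_sl2_def plus_sl2_def uminus_sl2_def minus_sl2_def algebra_simps)

end

definition sl2_scale :: "'a::field \<Rightarrow> 'a sl2 \<Rightarrow> 'a sl2" where
  "sl2_scale c u = Sl2 (c * coord_e u) (c * coord_f u) (c * coord_h u)"

definition sl2_bracket :: "'a::field sl2 \<Rightarrow> 'a sl2 \<Rightarrow> 'a sl2" where
  "sl2_bracket u v = Sl2
     (2 * (coord_h u * coord_e v - coord_e u * coord_h v))
     (- 2 * (coord_h u * coord_f v - coord_f u * coord_h v))
     (coord_e u * coord_f v - coord_f u * coord_e v)"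

definition sl2_e :: "'a::field sl2" where "sl2_e = Sl2 1 0 0"
definition sl2_f :: "'a::field sl2" where "sl2_f = Sl2 0 1 0"
definition sl2_h :: "'a::field sl2" where "sl2_h = Sl2 0 0 1"

definition sl2_x :: "'a::field sl2" where "sl2_x = sl2_scale 2 sl2_e - sl2_h"
definition sl2_y :: "'a::field sl2" where "sl2_y = sl2_scale (- 2) sl2_f - sl2_h"
definition sl2_z :: "'a::field sl2" where "sl2_z = sl2_h"

lemmas sl2_ops =
  zero_sl2_def plus_sl2_def uminus_sl2_def minus_sl2_def sl2_scale_def sl2_bracket_def
  sl2_e_def sl2_f_def sl2_h_def sl2_x_def sl2_y_def sl2_z_def

lemma sl2_basis_brackets:
  "sl2_bracket sl2_h sl2_e = sl2_scale 2 sl2_e"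
  "sl2_bracket sl2_h sl2_f = sl2_scale (- 2) sl2_f"
  "sl2_bracket sl2_e sl2_f = sl2_h"
  by (simp_all add: sl2_ops)

lemma sl2_equitable_brackets:
  "sl2_bracket sl2_x sl2_y = sl2_scale 2 sl2_x + sl2_scale 2 sl2_y"
  "sl2_bracket sl2_y sl2_z = sl2_scale 2 sl2_y + sl2_scale 2 sl2_z"
  "sl2_bracket sl2_z sl2_x = sl2_scale 2 sl2_z + sl2_scale 2 sl2_x"
  by (simp_all add: sl2_ops)

lemma vector_space_sl2: "vector_space (sl2_scale :: 'a::field \<Rightarrow> 'a sl2 \<Rightarrow> 'a sl2)"
  by standard (simp_all add: sl2_ops algebra_simps)

lemma sl2_bracket_bilinear:
  "sl2_bracket (u + u') v = sl2_bracket u v + sl2_bracket u' v"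
  "sl2_bracket u (v + v') = sl2_bracket u v + sl2_bracket u v'"
  "sl2_bracket (sl2_scale c u) v = sl2_scale c (sl2_bracket u v)"
  "sl2_bracket u (sl2_scale c v) = sl2_scale c (sl2_bracket u v)"
  by (simp_all add: sl2_ops algebra_simps)

lemma sl2_bracket_antisym: "sl2_bracket v u = - sl2_bracket u v"
  and sl2_bracket_self: "sl2_bracket u u = 0"
  and sl2_jacobi:
    "sl2_bracket u (sl2_bracket v w) + sl2_bracket v (sl2_bracket w u)
       + sl2_bracket w (sl2_bracket u v) = 0"
  by (simp_all add: sl2_ops algebra_simps)


subsection \<open>The ring \<open>\<A> = F[t, 1/t, 1/(t-1)]\<close>\<close>

text \<open>It is realised as the subring of the field of rational functions \<open>F(t)\<close> generated by the
  constants together with \<open>t\<close>, \<open>1/t\<close> and \<open>1/(t-1)\<close>.\<close>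

definition ratfun_const :: "'a::field \<Rightarrow> 'a poly fract" where
  "ratfun_const c = Fract [:c:] 1"

definition ratfun_t :: "'a::field poly fract" where
  "ratfun_t = Fract [:0, 1:] 1"

inductive_set three_point_subring :: "'a::field poly fract set" where
  const: "ratfun_const c \<in> three_point_subring"
| t: "ratfun_t \<in> three_point_subring"
| t_inv: "inverse ratfun_t \<in> three_point_subring"
| t1_inv: "inverse (ratfun_t - 1) \<in> three_point_subring"
| add: "r \<in> three_point_subring \<Longrightarrow> s \<in> three_point_subring \<Longrightarrow> r + s \<in> three_point_subring"
| mult: "r \<in> three_point_subring \<Longrightarrow> s \<in> three_point_subring \<Longrightarrow> r * s \<in> three_point_subring"

lemma ratfun_const_hom:
  "ratfun_const 0 = 0" "ratfun_const 1 = 1"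
  "ratfun_const (c + d) = ratfun_const c + ratfun_const d"
  "ratfun_const (c * d) = ratfun_const c * ratfun_const d"
  "ratfun_const (- c) = - ratfun_const c"
  by (simp_all add: ratfun_const_def fract_collapse one_pCons[symmetric] mult.commute)

lemma three_point_subring_0: "0 \<in> three_point_subring"
  and three_point_subring_1: "1 \<in> three_point_subring"
  using three_point_subring.const[of 0] three_point_subring.const[of 1]
  by (simp_all add: ratfun_const_hom)

lemma three_point_subring_uminus:
  assumes "r \<in> three_point_subring" shows "- r \<in> three_point_subring"
  using three_point_subring.mult[OF three_point_subring.const[of "- 1"] assms]
  by (simp add: ratfun_const_hom)

lemma three_point_subring_diff:
  "r \<in> three_point_subring \<Longrightarrow> s \<in> three_point_subring \<Longrightarrow> r - s \<in> three_point_subring"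
  using three_point_subring.add[OF _ three_point_subring_uminus, of r s] by simp

typedef (overloaded) 'a three_point = "three_point_subring :: 'a::field poly fract set"
  morphisms ratfun_of Abs_three_point
  using three_point_subring_0 by blast

setup_lifting type_definition_three_point

instantiation three_point :: (field) comm_ring_1
begin

lift_definition zero_three_point :: "'a three_point" is 0
  by (rule three_point_subring_0)
lift_definition one_three_point :: "'a three_point" is 1
  by (rule three_point_subring_1)
lift_definition plus_three_point :: "'a three_point \<Rightarrow> 'a three_point \<Rightarrow> 'a three_point" is "(+)"
  by (rule three_point_subring.add)
lift_definition times_three_point :: "'a three_point \<Rightarrow> 'a three_point \<Rightarrow> 'a three_point" is "(*)"
  by (rule three_point_subring.mult)
lift_definition uminus_three_point :: "'a three_point \<Rightarrow> 'a three_point" is uminus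
  by (rule three_point_subring_uminus)
lift_definition minus_three_point :: "'a three_point \<Rightarrow> 'a three_point \<Rightarrow> 'a three_point" is minus
  by (rule three_point_subring_diff)

instance
  by standard (transfer; simp add: algebra_simps)+

end

text \<open>Inverses are taken in \<open>F(t)\<close>; elements that are not units of the subring get the dummy
  inverse 0. This makes \<open>powi\<close> available for the unit \<open>- t\<close>.\<close>

instantiation three_point :: (field) inverse
begin

lift_definition inverse_three_point :: "'a three_point \<Rightarrow> 'a three_point" is
  "\<lambda>r. if inverse r \<in> three_point_subring then inverse r else 0"
  by (simp add: three_point_subring_0)

definition divide_three_point :: "'a three_point \<Rightarrow> 'a three_point \<Rightarrow> 'a three_point" where
  "divide_three_point r s = r * inverse s"

instance ..

end

lift_definition three_point_const :: "'a::field \<Rightarrow> 'a three_point" is ratfun_const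
  by (rule three_point_subring.const)

lift_definition t :: "'a::field three_point" is ratfun_t
  by (rule three_point_subring.t)

definition three_point_scale :: "'a::field \<Rightarrow> 'a three_point \<Rightarrow> 'a three_point" where
  "three_point_scale c a = three_point_const c * a"

lemma three_point_const_hom:
  "three_point_const 0 = 0" "three_point_const 1 = 1"
  "three_point_const (c + d) = three_point_const c + three_point_const d"
  "three_point_const (c * d) = three_point_const c * three_point_const d"
  by (transfer; simp add: ratfun_const_hom)+

lemma vector_space_three_point:
  "vector_space (three_point_scale :: 'a::field \<Rightarrow> 'a three_point \<Rightarrow> 'a three_point)"
  by standard (simp_all add: three_point_scale_def three_point_const_hom algebra_simps)

lemma ratfun_t_nonzero: "ratfun_t \<noteq> 0"
  by (simp add: ratfun_t_def Zero_fract_def eq_fract)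

lemma ratfun_t_neq_1: "ratfun_t \<noteq> 1"
  by (simp add: ratfun_t_def One_fract_def eq_fract one_pCons)

lemma ratfun_of_inverse_neg_t: "ratfun_of (inverse (- t)) = inverse (- ratfun_t)"
  by transfer (simp add: three_point_subring_uminus three_point_subring.t_inv)

lemma ratfun_of_neg_t_powi: "ratfun_of ((- t) powi k) = (- ratfun_t) powi k"
proof -
  have pow: "ratfun_of (r ^ n) = ratfun_of r ^ n" for r :: "'a three_point" and n
    by (induction n) (simp_all add: one_three_point.rep_eq times_three_point.rep_eq)
  show ?thesis
    by (simp add: power_int_def pow ratfun_of_inverse_neg_t uminus_three_point.rep_eq t.rep_eq)
qed

lemma three_point_units: "t * inverse t = 1" "(t - 1) * inverse (t - 1) = 1"
  by (transfer; simp add: three_point_subring.t_inv three_point_subring.t1_inv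
      ratfun_t_nonzero ratfun_t_neq_1)+


lifting_forget three_point.lifting


subsection \<open>The vector space \<open>sl2 \<otimes> \<A>\<close>\<close>

text \<open>The tensor product is the free abelian group on the pairs \<open>(v, w)\<close> modulo the subgroup
  \<open>tensor_null\<close> generated by the biadditivity relations and the relations
  \<open>(c v, w) = (v, c w)\<close>.\<close>

inductive_set tensor_null ::
  "('c \<Rightarrow> 'v \<Rightarrow> 'v) \<Rightarrow> ('c \<Rightarrow> 'w \<Rightarrow> 'w) \<Rightarrow> (('v::ab_group_add \<times> 'w::ab_group_add) \<Rightarrow>\<^sub>0 int) set"
  for sv :: "'c \<Rightarrow> 'v \<Rightarrow> 'v" and sw :: "'c \<Rightarrow> 'w \<Rightarrow> 'w"
where
  zero: "0 \<in> tensor_null sv sw"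
| diff: "p \<in> tensor_null sv sw \<Longrightarrow> q \<in> tensor_null sv sw \<Longrightarrow> p - q \<in> tensor_null sv sw"
| add_left: "frag_of (v + v', w) - frag_of (v, w) - frag_of (v', w) \<in> tensor_null sv sw"
| add_right: "frag_of (v, w + w') - frag_of (v, w) - frag_of (v, w') \<in> tensor_null sv sw"
| scale: "frag_of (sv c v, w) - frag_of (v, sw c w) \<in> tensor_null sv sw"

lemma tensor_null_uminus: "p \<in> tensor_null sv sw \<Longrightarrow> - p \<in> tensor_null sv sw"
  using tensor_null.diff[OF tensor_null.zero] by fastforce

lemma tensor_null_add:
  "p \<in> tensor_null sv sw \<Longrightarrow> q \<in> tensor_null sv sw \<Longrightarrow> p + q \<in> tensor_null sv sw"
  using tensor_null.diff[OF _ tensor_null_uminus] by fastforce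

lemma tensor_null_extend:
  assumes "p \<in> tensor_null sv sw"
    and "\<And>v v' w. g (v + v', w) - g (v, w) - g (v', w) \<in> tensor_null sv' sw'"
    and "\<And>v w w'. g (v, w + w') - g (v, w) - g (v, w') \<in> tensor_null sv' sw'"
    and "\<And>c v w. g (sv c v, w) - g (v, sw c w) \<in> tensor_null sv' sw'"
  shows "frag_extend g p \<in> tensor_null sv' sw'"
  using assms(1)
  by induction (simp_all add: frag_extend_diff tensor_null.zero tensor_null.diff assms(2-4))

abbreviation loop_null :: "(('a::field sl2 \<times> 'a three_point) \<Rightarrow>\<^sub>0 int) set" where
  "loop_null \<equiv> tensor_null sl2_scale three_point_scale"

definition loop_rel ::
  "(('a::field sl2 \<times> 'a three_point) \<Rightarrow>\<^sub>0 int) \<Rightarrow> (('a sl2 \<times> 'a three_point) \<Rightarrow>\<^sub>0 int) \<Rightarrow> bool" where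
  "loop_rel p q \<longleftrightarrow> p - q \<in> loop_null"

lemma equivp_loop_rel: "equivp loop_rel"
proof (rule equivpI)
  show "reflp loop_rel"
    by (simp add: reflp_def loop_rel_def tensor_null.zero)
  show "symp loop_rel"
    using tensor_null_uminus by (fastforce simp: symp_def loop_rel_def)
  show "transp loop_rel"
    using tensor_null_add by (fastforce simp: transp_def loop_rel_def)
qed

quotient_type (overloaded) 'a loop = "('a::field sl2 \<times> 'a three_point) \<Rightarrow>\<^sub>0 int" / loop_rel
  by (rule equivp_loop_rel)

instantiation loop :: (field) ab_group_add
begin

lift_definition zero_loop :: "'a loop" is 0 .

lift_definition plus_loop :: "'a loop \<Rightarrow> 'a loop \<Rightarrow> 'a loop" is "(+)"
  unfolding loop_rel_def using tensor_null_add by (fastforce simp: algebra_simps)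

lift_definition uminus_loop :: "'a loop \<Rightarrow> 'a loop" is uminus
  unfolding loop_rel_def using tensor_null_uminus by fastforce

lift_definition minus_loop :: "'a loop \<Rightarrow> 'a loop \<Rightarrow> 'a loop" is minus
  unfolding loop_rel_def using tensor_null.diff by (fastforce simp: algebra_simps)

instance
  by standard (transfer; simp add: loop_rel_def tensor_null.zero)+

end

lift_definition loop_tensor :: "'a::field sl2 \<Rightarrow> 'a three_point \<Rightarrow> 'a loop"  (infix "\<otimes>" 72)
  is "\<lambda>u a. frag_of (u, a)" .

lift_definition loop_scale :: "'a::field \<Rightarrow> 'a loop \<Rightarrow> 'a loop"  (infixr "*\<^sub>L" 75)
  is "\<lambda>c. frag_extend (\<lambda>(u, a). frag_of (sl2_scale c u, a))"
proof -
  interpret V: vector_space "sl2_scale :: 'a \<Rightarrow> 'a sl2 \<Rightarrow> 'a sl2"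
    by (rule vector_space_sl2)
  fix c :: 'a and p q :: "('a sl2 \<times> 'a three_point) \<Rightarrow>\<^sub>0 int"
  assume "loop_rel p q"
  then have "p - q \<in> loop_null"
    by (simp add: loop_rel_def)
  then have "frag_extend (\<lambda>(u, a). frag_of (sl2_scale c u, a)) (p - q) \<in> loop_null"
  proof (rule tensor_null_extend; clarsimp)
    fix d v and w :: "'a three_point"
    show "frag_of (sl2_scale (c * d) v, w) - frag_of (sl2_scale c v, three_point_scale d w)
            \<in> loop_null"
      using tensor_null.scale[of sl2_scale d "sl2_scale c v" w three_point_scale]
      by (simp add: mult.commute)
  qed (use tensor_null.add_left tensor_null.add_right in \<open>force simp: V.scale_right_distrib\<close>)+
  then show "loop_rel (frag_extend (\<lambda>(u, a). frag_of (sl2_scale c u, a)) p)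
                      (frag_extend (\<lambda>(u, a). frag_of (sl2_scale c u, a)) q)"
    by (simp add: loop_rel_def frag_extend_diff)
qed

lemma tensor_add_left: "(u + v) \<otimes> a = u \<otimes> a + v \<otimes> a"
  by transfer (simp add: loop_rel_def tensor_null.add_left diff_diff_eq[symmetric])

lemma tensor_add_right: "u \<otimes> (a + b) = u \<otimes> a + u \<otimes> b"
  by transfer (simp add: loop_rel_def tensor_null.add_right diff_diff_eq[symmetric])

lemma tensor_scale_left: "sl2_scale c u \<otimes> a = c *\<^sub>L (u \<otimes> a)"
  by transfer (simp add: loop_rel_def tensor_null.zero)

lemma tensor_scale_right: "u \<otimes> three_point_scale c a = c *\<^sub>L (u \<otimes> a)"
  unfolding tensor_scale_left[symmetric]
  by transfer (metis equivp_loop_rel equivp_symp loop_rel_def tensor_null.scale)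

lemma loop_induct [case_names zero tensor diff]:
  assumes "P 0" "\<And>u a. P (u \<otimes> a)" "\<And>p q. P p \<Longrightarrow> P q \<Longrightarrow> P (p - q)"
  shows "P p"
proof -
  have "P (abs_loop q)" for q
    using subset_UNIV
  proof (induction q rule: frag_induction)
    case zero then show ?case
      using assms(1) by (simp add: zero_loop.abs_eq)
  next
    case (one x) then show ?case
      using assms(2)[of "fst x" "snd x"] by (simp add: loop_tensor.abs_eq)
  next
    case (diff a b) then show ?case
      using assms(3)[of "abs_loop a" "abs_loop b"] by (simp add: minus_loop.abs_eq)
  qed
  then show ?thesis
    by (metis Quotient3_abs_rep Quotient3_loop)
qed

lemma loop_scale_diff: "c *\<^sub>L (p - q) = c *\<^sub>L p - c *\<^sub>L q"
  by transfer (simp add: loop_rel_def frag_extend_diff tensor_null.zero)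

lemma loop_scale_zero: "c *\<^sub>L 0 = 0"
  using loop_scale_diff[of c 0 0] by simp

lemma loop_scale_add: "c *\<^sub>L (p + q) = c *\<^sub>L p + c *\<^sub>L q"
  using loop_scale_diff[of c "p + q" q] by simp

interpretation loop: vector_space "loop_scale :: 'a::field \<Rightarrow> 'a loop \<Rightarrow> 'a loop"
proof
  interpret V: vector_space "sl2_scale :: 'a \<Rightarrow> 'a sl2 \<Rightarrow> 'a sl2"
    by (rule vector_space_sl2)
  fix c d :: 'a and p q :: "'a loop"
  show "c *\<^sub>L (p + q) = c *\<^sub>L p + c *\<^sub>L q"
    by (rule loop_scale_add)
  show "(c + d) *\<^sub>L p = c *\<^sub>L p + d *\<^sub>L p"
    by (induction p rule: loop_induct)
      (simp_all add: loop_scale_zero loop_scale_diff tensor_scale_left[symmetric]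
        V.scale_left_distrib tensor_add_left)
  show "c *\<^sub>L d *\<^sub>L p = (c * d) *\<^sub>L p"
    by (induction p rule: loop_induct)
      (simp_all add: loop_scale_zero loop_scale_diff tensor_scale_left[symmetric])
  show "1 *\<^sub>L p = p"
    by (induction p rule: loop_induct)
      (simp_all add: loop_scale_zero loop_scale_diff tensor_scale_left[symmetric])
qed


subsection \<open>The Lie bracket and the right \<open>\<A>\<close>-module structure\<close>

definition frag_bracket ::
  "(('a::field sl2 \<times> 'a three_point) \<Rightarrow>\<^sub>0 int) \<Rightarrow> (('a sl2 \<times> 'a three_point) \<Rightarrow>\<^sub>0 int)
    \<Rightarrow> (('a sl2 \<times> 'a three_point) \<Rightarrow>\<^sub>0 int)" where
  "frag_bracket p q =
     frag_extend (\<lambda>(u, a). frag_extend (\<lambda>(v, b). frag_of (sl2_bracket u v, a * b)) q) p"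

lemma frag_bracket_of: "frag_bracket (frag_of (u, a)) (frag_of (v, b)) = frag_of (sl2_bracket u v, a * b)"
  by (simp add: frag_bracket_def)

lemma frag_bracket_diff_left: "frag_bracket (p - p') q = frag_bracket p q - frag_bracket p' q"
  by (simp add: frag_bracket_def frag_extend_diff)

lemma frag_bracket_diff_right: "frag_bracket p (q - q') = frag_bracket p q - frag_bracket p q'"
  using subset_UNIV[of "Poly_Mapping.keys p"]
  by (induction p rule: frag_induction)
    (auto simp: frag_bracket_def frag_extend_diff)

lemma frag_bracket_zero: "frag_bracket 0 q = 0" "frag_bracket p 0 = 0"
  using frag_bracket_diff_left[of 0 0] frag_bracket_diff_right[of p 0 0] by simp_all

lemma frag_bracket_null_left:
  assumes "p \<in> loop_null" shows "frag_bracket p q \<in> loop_null"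
  using subset_UNIV[of "Poly_Mapping.keys q"]
proof (induction q rule: frag_induction)
  case (one x)
  obtain v b where x: "x = (v, b)" by force
  have scale: "three_point_scale c a * b = three_point_scale c (a * b)" for c a
    by (simp add: three_point_scale_def algebra_simps)
  show ?case
    using assms
    unfolding frag_bracket_def x frag_extend_of
    by (rule tensor_null_extend)
      (simp_all add: sl2_bracket_bilinear distrib_right scale tensor_null.add_left
        tensor_null.add_right tensor_null.scale)
qed (simp_all add: frag_bracket_zero frag_bracket_diff_right tensor_null.zero tensor_null.diff)

lemma frag_bracket_null_right:
  assumes "q \<in> loop_null" shows "frag_bracket p q \<in> loop_null"
  using subset_UNIV[of "Poly_Mapping.keys p"]
proof (induction p rule: frag_induction)
  case (one x)
  obtain u a where x: "x = (u, a)" by force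
  have scale: "a * three_point_scale c b = three_point_scale c (a * b)" for c b
    by (simp add: three_point_scale_def algebra_simps)
  show ?case
    using assms
    unfolding frag_bracket_def x frag_extend_of prod.case
    by (rule tensor_null_extend)
      (simp_all add: sl2_bracket_bilinear distrib_left scale tensor_null.add_left
        tensor_null.add_right tensor_null.scale)
qed (simp_all add: frag_bracket_zero frag_bracket_diff_left tensor_null.zero tensor_null.diff)

lift_definition loop_bracket :: "'a::field loop \<Rightarrow> 'a loop \<Rightarrow> 'a loop"  ("[_, _]\<^sub>L")
  is frag_bracket
proof -
  fix p p' q q' :: "('a sl2 \<times> 'a three_point) \<Rightarrow>\<^sub>0 int"
  assume "loop_rel p p'" "loop_rel q q'"
  then have "frag_bracket (p - p') q + frag_bracket p' (q - q') \<in> loop_null"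
    by (simp add: loop_rel_def tensor_null_add frag_bracket_null_left frag_bracket_null_right)
  then show "loop_rel (frag_bracket p q) (frag_bracket p' q')"
    by (simp add: loop_rel_def frag_bracket_diff_left frag_bracket_diff_right)
qed

lift_definition loop_act :: "'a::field loop \<Rightarrow> 'a three_point \<Rightarrow> 'a loop"  (infixl "\<cdot>" 75)
  is "\<lambda>p b. frag_extend (\<lambda>(u, a). frag_of (u, a * b)) p"
proof -
  fix b :: "'a three_point" and p q :: "('a sl2 \<times> 'a three_point) \<Rightarrow>\<^sub>0 int"
  assume "loop_rel p q"
  then have null: "p - q \<in> loop_null"
    by (simp add: loop_rel_def)
  have scale: "three_point_scale c a * b = three_point_scale c (a * b)" for c a
    by (simp add: three_point_scale_def algebra_simps)
  from null have "frag_extend (\<lambda>(u, a). frag_of (u, a * b)) (p - q) \<in> loop_null"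
    by (rule tensor_null_extend)
      (simp_all add: distrib_right scale tensor_null.add_left tensor_null.add_right tensor_null.scale)
  then show "loop_rel (frag_extend (\<lambda>(u, a). frag_of (u, a * b)) p)
                      (frag_extend (\<lambda>(u, a). frag_of (u, a * b)) q)"
    by (simp add: loop_rel_def frag_extend_diff)
qed

lemma loop_bracket_tensor: "[u \<otimes> a, v \<otimes> b]\<^sub>L = sl2_bracket u v \<otimes> (a * b)"
  by transfer (simp add: frag_bracket_of loop_rel_def tensor_null.zero)

lemma loop_act_tensor: "(u \<otimes> a) \<cdot> b = u \<otimes> (a * b)"
  by transfer (simp add: loop_rel_def tensor_null.zero)

lemma loop_act_diff: "(p - q) \<cdot> b = p \<cdot> b - q \<cdot> b"
  by transfer (simp add: loop_rel_def frag_extend_diff tensor_null.zero)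

lemma loop_bracket_diff:
  "[p - p', q]\<^sub>L = [p, q]\<^sub>L - [p', q]\<^sub>L"
  "[p, q - q']\<^sub>L = [p, q]\<^sub>L - [p, q']\<^sub>L"
  by (transfer; simp add: loop_rel_def frag_bracket_diff_left frag_bracket_diff_right
      tensor_null.zero)+

lemma loop_bracket_zero: "[0, q]\<^sub>L = 0" "[p, 0]\<^sub>L = 0"
  using loop_bracket_diff(1)[of 0 0 q] loop_bracket_diff(2)[of p 0 0] by simp_all

lemma loop_bracket_scale:
  "[c *\<^sub>L p, q]\<^sub>L = c *\<^sub>L [p, q]\<^sub>L" "[p, c *\<^sub>L q]\<^sub>L = c *\<^sub>L [p, q]\<^sub>L"
proof -
  have "[c *\<^sub>L p, q]\<^sub>L = c *\<^sub>L [p, q]\<^sub>L \<and> [p, c *\<^sub>L q]\<^sub>L = c *\<^sub>L [p, q]\<^sub>L"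
  proof (induction p rule: loop_induct)
    case (tensor u a)
    show ?case
      by (induction q rule: loop_induct)
        (simp_all add: loop_bracket_zero loop_bracket_diff loop.scale_right_diff_distrib
          loop_bracket_tensor sl2_bracket_bilinear tensor_scale_left[symmetric])
  qed (simp_all add: loop_bracket_zero loop_bracket_diff loop.scale_right_diff_distrib)
  then show "[c *\<^sub>L p, q]\<^sub>L = c *\<^sub>L [p, q]\<^sub>L" "[p, c *\<^sub>L q]\<^sub>L = c *\<^sub>L [p, q]\<^sub>L"
    by blast+
qed


lemma tensor_minus_left: "(- u) \<otimes> a = - (u \<otimes> a)"
  using tensor_add_left[of "- u" u a] tensor_add_left[of 0 0 a] by (simp add: eq_neg_iff_add_eq_0)

lemma tensor_zero_left: "0 \<otimes> a = 0"
  using tensor_add_left[of 0 0 a] by simp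

lemma loop_bracket_antisym: "[q, p]\<^sub>L = - [p, q]\<^sub>L"
proof (induction p rule: loop_induct)
  case (tensor u a)
  show ?case
  proof (induction q rule: loop_induct)
    case (tensor v b)
    show ?case
      using sl2_bracket_antisym[of v u]
      by (simp add: loop_bracket_tensor tensor_minus_left[symmetric] mult.commute)
  qed (simp_all add: loop_bracket_zero loop_bracket_diff)
qed (simp_all add: loop_bracket_zero loop_bracket_diff)

lemma loop_bracket_self: "[p, p]\<^sub>L = 0"
proof (induction p rule: loop_induct)
  case (diff p q)
  then show ?case
    using loop_bracket_antisym[of p q] by (simp add: loop_bracket_diff)
qed (simp_all add: loop_bracket_zero loop_bracket_tensor sl2_bracket_self tensor_zero_left)

lemma loop_jacobi:
  fixes p q r :: "'a::field loop"
  shows "[p, [q, r]\<^sub>L]\<^sub>L + [q, [r, p]\<^sub>L]\<^sub>L + [r, [p, q]\<^sub>L]\<^sub>L = 0"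
proof -
  have sum3: "(k - k') + (l - l') + (m - m') = (k + l + m) - (k' + l' + m')"
    for k k' l l' m m' :: "'a loop"
    by (simp add: algebra_simps)
  show ?thesis
  proof (induction p rule: loop_induct)
    case (tensor u a)
    show ?case
    proof (induction q rule: loop_induct)
      case (tensor v b)
      show ?case
      proof (induction r rule: loop_induct)
        case (tensor w c)
        have eqs: "a * (b * c) = b * (c * a)" "c * (a * b) = b * (c * a)"
          by (simp_all add: ac_simps)
        show ?case
          unfolding loop_bracket_tensor eqs tensor_add_left[symmetric] sl2_jacobi
          by (rule tensor_zero_left)
      qed (simp_all add: loop_bracket_zero loop_bracket_diff sum3)
    qed (simp_all add: loop_bracket_zero loop_bracket_diff sum3)
  qed (simp_all add: loop_bracket_zero loop_bracket_diff sum3)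
qed


subsection \<open>The Onsager Lie algebra\<close>

definition lie_subalgebra :: "'a::field loop set \<Rightarrow> bool" where
  "lie_subalgebra S \<longleftrightarrow> loop.subspace S \<and> (\<forall>p\<in>S. \<forall>q\<in>S. [p, q]\<^sub>L \<in> S)"

definition onsager_A :: "'a::field loop" where
  "onsager_A = sl2_x \<otimes> 1"

definition onsager_B :: "'a::field loop" where
  "onsager_B = sl2_y \<otimes> t + sl2_z \<otimes> (t - 1)"

text \<open>The abstract algebra with generators \<open>A\<close>, \<open>B\<close> and the Dolan--Grady relations embeds into
  \<open>sl2 \<otimes> \<A>\<close> via \<open>A \<mapsto> onsager_A\<close>, \<open>B \<mapsto> onsager_B\<close>, and is identified with its image, the Lie
  subalgebra generated by these two elements.\<close>

definition onsager :: "'a::field loop set" where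
  "onsager = lie_subalgebra hull {onsager_A, onsager_B}"

definition basis_family :: "('i \<Rightarrow> 'a::field loop) \<Rightarrow> 'a loop set \<Rightarrow> bool" where
  "basis_family b S \<longleftrightarrow> inj b \<and> loop.independent (range b) \<and> loop.span (range b) = S"

end

theory Submission
  imports Defs
begin

text \<open>Over \<open>\<A>\<close>, the elements \<open>A\<^sub>0\<close>, \<open>B\<^sub>0\<close>, \<open>\<psi>\<^sub>1\<close> form a basis of \<open>sl2 \<otimes> \<A>\<close>, because \<open>t\<close> and \<open>t - 1\<close> are
  units. Its dual basis consists of \<open>\<A>\<close>-linear functionals which turn a linear dependency of the
  proposed basis of \<open>O\<close> into a linear dependency between powers of \<open>- t\<close>. The bracket relations show
  that the span is closed under brackets; conversely \<open>[A\<^sub>0, B\<^sub>j]\<close>, \<open>[\<psi>\<^sub>1, A\<^sub>j]\<close> and \<open>[B\<^sub>j, \<psi>\<^sub>1]\<close>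
  successively yield \<open>\<psi>\<^bsub>j+1\<^esub>\<close>, \<open>A\<^bsub>j+1\<^esub>\<close> and \<open>B\<^bsub>j+1\<^esub>\<close> from \<open>A\<^sub>0\<close> and \<open>B\<^sub>0\<close>.\<close>

subsection \<open>Independent families\<close>

context vector_space
begin

text \<open>Two indices with the same image would satisfy the relation with coefficients 1 and -1,
  so \<open>b\<close> is injective. A relation between vectors of \<open>range b\<close> then pulls
  back to one between indices.\<close>

lemma independent_familyI:
  assumes "\<And>S u s. finite S \<Longrightarrow> (\<Sum>s\<in>S. scale (u s) (b s)) = 0 \<Longrightarrow> s \<in> S \<Longrightarrow> u s = 0"
  shows "inj b" "independent (range b)"
proof -
  show inj: "inj b"
  proof (rule injI, rule ccontr)
    fix i j assume "b i = b j" "i \<noteq> j"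
    then have "(\<Sum>s\<in>{i, j}. scale (if s = i then 1 else - 1) (b s)) = 0"
      by simp
    from assms[OF _ this, of i] show False by simp
  qed
  show "independent (range b)"
  proof
    assume "dependent (range b)"
    then obtain V u v where V: "finite V" "V \<subseteq> range b" "(\<Sum>v\<in>V. scale (u v) v) = 0" "v \<in> V" "u v \<noteq> 0"
      unfolding dependent_explicit by blast
    obtain S where S: "V = b ` S" using V(2) by (auto simp: subset_image_iff)
    have inj': "inj_on b S" using inj by (rule inj_on_subset) simp
    have "finite S" using V(1) S inj' by (simp add: finite_image_iff)
    moreover have "(\<Sum>s\<in>S. scale (u (b s)) (b s)) = 0"
      using V(3) unfolding S by (simp add: sum.reindex[OF inj'])
    moreover obtain s where "s \<in> S" "v = b s" using V(4) S by blast
    ultimately show False using assms[of S "\<lambda>s. u (b s)" s] V(5) by simp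
  qed
qed

end


subsection \<open>Powers of \<open>- t\<close>\<close>

lemma unit_cancel_left: "a * b = 1 \<Longrightarrow> b * (a * c) = c" for a b c :: "'r::comm_monoid_mult"
  by (metis mult.assoc mult.commute mult_1)

lemma three_point_const_2: "three_point_const 2 = 2"
  using three_point_const_hom(3)[of 1 1] by (simp add: three_point_const_hom(2))

lemma three_point_const_minus: "three_point_const (- c) = - three_point_const c"
  using three_point_const_hom(3)[of c "- c"]
  by (simp add: three_point_const_hom(1) eq_neg_iff_add_eq_0 add.commute)

lemma three_point_const_half: "2 * three_point_const (1 / 2 :: 'a::field_char_0) = 1"
proof -
  have "three_point_const (2 * (1 / 2) :: 'a) = 1"
    by (simp add: three_point_const_hom)
  then show ?thesis
    by (simp only: three_point_const_hom(4) three_point_const_2)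
qed

lemma neg_t_inverse: "(- t) * inverse (- t) = 1"
  by (simp add: ratfun_of_inject[symmetric] times_three_point.rep_eq one_three_point.rep_eq
      ratfun_of_inverse_neg_t uminus_three_point.rep_eq t.rep_eq ratfun_t_nonzero)

text \<open>Only \<open>i = 0\<close> involves a negative exponent, and there \<open>j > 0\<close>
  cancels one factor \<open>- t\<close> against its inverse. All other cases are laws of natural
  powers.\<close>

lemma neg_t_powi_mult_power:
  "(- t) powi (int i - 1) * (- t) ^ j = (- t :: 'a::field three_point) powi (int (i + j) - 1)"
proof (cases i)
  case 0
  show ?thesis
  proof (cases j)
    case 0
    then show ?thesis by simp
  next
    case (Suc k)
    have "inverse (- t) * ((- t) * (- t) ^ k) = (- t :: 'a three_point) ^ k"
      by (rule unit_cancel_left) (rule neg_t_inverse)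
    then show ?thesis
      using \<open>i = 0\<close> Suc by (simp add: power_int_def)
  qed
next
  case (Suc k)
  then have "int i - 1 = int k" "int (i + j) - 1 = int (k + j)"
    by simp_all
  then show ?thesis
    by (simp only: power_int_of_nat power_add)
qed

lemma ratfun_of_sum: "ratfun_of (\<Sum>s\<in>S. f s) = (\<Sum>s\<in>S. ratfun_of (f s))"
  by (induction S rule: infinite_finite_induct)
    (simp_all add: zero_three_point.rep_eq plus_three_point.rep_eq)

lemma Fract_sum_1: "(\<Sum>s\<in>S. Fract (f s) 1) = Fract (\<Sum>s\<in>S. f s) (1 :: 'b::idom)"
  by (induction S rule: infinite_finite_induct) (simp_all add: Zero_fract_def)

lemma ratfun_of_const_neg_t_power:
  "ratfun_of (three_point_const c * (- t) ^ n) = Fract (monom (c * (- 1) ^ n) n) 1"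
proof (induction n)
  case 0
  then show ?case
    by (simp add: three_point_const.rep_eq ratfun_const_def monom_0)
next
  case (Suc n)
  have "ratfun_of (three_point_const c * (- t) ^ Suc n)
      = ratfun_of (three_point_const c * (- t) ^ n) * - ratfun_t"
    by (simp add: times_three_point.rep_eq[symmetric] uminus_three_point.rep_eq[symmetric]
        t.rep_eq[symmetric] mult_ac)
  also have "\<dots> = Fract (monom (c * (- 1) ^ Suc n) (Suc n)) 1"
    by (simp add: Suc ratfun_t_def monom_Suc minus_monom mult.commute[of _ "[:0, 1:]"])
  finally show ?case .
qed

text \<open>Viewed in \<open>F(t)\<close>, the relation says that a polynomial vanishes. As
  \<open>n\<close> is injective on \<open>S\<close>, its coefficient at degree \<open>n s\<close> is
  \<open>c s\<close> up to sign.\<close>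

lemma neg_t_powers_independent:
  assumes "finite S" "inj_on n S" "(\<Sum>s\<in>S. three_point_const (c s) * (- t) ^ n s) = 0" "s \<in> S"
  shows "c s = 0"
proof -
  have "Fract (\<Sum>s\<in>S. monom (c s * (- 1) ^ n s) (n s)) 1 = 0"
    using arg_cong[OF assms(3), of ratfun_of]
    by (simp add: ratfun_of_sum ratfun_of_const_neg_t_power Fract_sum_1 zero_three_point.rep_eq)
  then have "coeff (\<Sum>s\<in>S. monom (c s * (- 1) ^ n s) (n s)) (n s) = 0"
    by (simp add: Zero_fract_def eq_fract)
  also have "coeff (\<Sum>s\<in>S. monom (c s * (- 1) ^ n s) (n s)) (n s)
      = (\<Sum>s'\<in>S. if s' = s then c s * (- 1) ^ n s else 0)"
    unfolding coeff_sum coeff_monom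
    by (rule sum.cong) (use assms(2,4) in \<open>auto dest: inj_onD\<close>)
  finally show ?thesis
    using assms(1,4) by simp
qed


subsection \<open>\<open>\<A>\<close>-linear functionals\<close>

text \<open>The additive map from the free abelian group on the index type to the ring that extends
  \<open>g\<close>.\<close>

definition frag_eval :: "('i \<Rightarrow> 'r::comm_ring_1) \<Rightarrow> ('i \<Rightarrow>\<^sub>0 int) \<Rightarrow> 'r" where
  "frag_eval g p = (\<Sum>k\<in>Poly_Mapping.keys p. of_int (Poly_Mapping.lookup p k) * g k)"

lemma frag_eval_superset:
  assumes "finite K" "Poly_Mapping.keys p \<subseteq> K"
  shows "frag_eval g p = (\<Sum>k\<in>K. of_int (Poly_Mapping.lookup p k) * g k)"
  unfolding frag_eval_def using assms
  by (intro sum.mono_neutral_left) (auto simp: in_keys_iff)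

lemma frag_eval_of: "frag_eval g (frag_of k) = g k"
  by (simp add: frag_eval_def)

lemma frag_eval_zero: "frag_eval g 0 = 0"
  by (simp add: frag_eval_def)

lemma frag_eval_diff: "frag_eval g (p - q) = frag_eval g p - frag_eval g q"
proof -
  let ?K = "Poly_Mapping.keys p \<union> Poly_Mapping.keys q"
  have "Poly_Mapping.keys (p - q) \<subseteq> ?K"
    by (auto simp: in_keys_iff lookup_minus)
  then show ?thesis
    by (simp add: frag_eval_superset[of ?K] lookup_minus algebra_simps sum_subtractf)
qed

text \<open>The triple \<open>w\<close> records the values that the functional takes at
  \<open>e \<otimes> 1\<close>, \<open>f \<otimes> 1\<close> and \<open>h \<otimes> 1\<close>; the
  type \<open>sl2\<close> over \<A> serves merely as a type of triples.\<close>

definition tensor_functional :: "'a::field three_point sl2 \<Rightarrow> 'a sl2 \<times> 'a three_point \<Rightarrow> 'a three_point" where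
  "tensor_functional w = (\<lambda>(u, a).
     (three_point_const (coord_e u) * coord_e w + three_point_const (coord_f u) * coord_f w
       + three_point_const (coord_h u) * coord_h w) * a)"

text \<open>The evaluation descends to the tensor product because \<open>tensor_functional w\<close>
  is additive in both arguments and moves scalars across, so all generators of
  \<open>loop_null\<close> are sent to 0.\<close>

lift_definition loop_functional :: "'a::field three_point sl2 \<Rightarrow> 'a loop \<Rightarrow> 'a three_point"
  is "\<lambda>w. frag_eval (tensor_functional w)"
proof -
  fix w :: "'a three_point sl2" and p q :: "('a sl2 \<times> 'a three_point) \<Rightarrow>\<^sub>0 int"
  assume "loop_rel p q"
  then have "p - q \<in> loop_null"
    by (simp add: loop_rel_def)
  then have "frag_eval (tensor_functional w) (p - q) = 0"
    by induction
      (simp_all only: frag_eval_diff frag_eval_of frag_eval_zero,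
       simp_all add: tensor_functional_def sl2_ops three_point_const_hom three_point_scale_def
         algebra_simps)
  then show "frag_eval (tensor_functional w) p = frag_eval (tensor_functional w) q"
    by (simp add: frag_eval_diff)
qed

lemma loop_functional_tensor: "loop_functional w (u \<otimes> a) = tensor_functional w (u, a)"
  by transfer (simp add: frag_eval_of)

lemma loop_functional_zero: "loop_functional w 0 = 0"
  by transfer (simp add: frag_eval_zero)

lemma loop_functional_diff: "loop_functional w (p - q) = loop_functional w p - loop_functional w q"
  by transfer (simp add: frag_eval_diff)

lemma loop_functional_add: "loop_functional w (p + q) = loop_functional w p + loop_functional w q"
  using loop_functional_diff[of w "p + q" q] by simp

lemma loop_functional_scale: "loop_functional w (c *\<^sub>L p) = three_point_const c * loop_functional w p"
  by (induction p rule: loop_induct)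
    (simp_all add: loop_scale_zero loop_functional_zero loop_scale_diff loop_functional_diff
      tensor_scale_left[symmetric] loop_functional_tensor tensor_functional_def sl2_scale_def
      three_point_const_hom algebra_simps)

lemma loop_functional_sum: "loop_functional w (\<Sum>s\<in>S. f s) = (\<Sum>s\<in>S. loop_functional w (f s))"
  by (induction S rule: infinite_finite_induct)
    (simp_all add: loop_functional_zero loop_functional_add)


subsection \<open>Coordinates in the equitable basis\<close>

text \<open>In these coordinates every bracket relation becomes three identities in the commutative
  ring \<A>.\<close>

definition equitable :: "'a::field three_point \<Rightarrow> 'a three_point \<Rightarrow> 'a three_point \<Rightarrow> 'a loop" where
  "equitable a b c = sl2_x \<otimes> a + sl2_y \<otimes> b + sl2_z \<otimes> c"

lemma tensor_zero_right: "u \<otimes> 0 = 0"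
  using tensor_add_right[of u 0 0] by simp

lemma tensor_minus_right: "u \<otimes> (- a) = - (u \<otimes> a)"
  using tensor_add_right[of u "- a" a] by (simp add: tensor_zero_right eq_neg_iff_add_eq_0)

lemma tensor_diff_right: "u \<otimes> (a - b) = u \<otimes> a - u \<otimes> b"
  using tensor_add_right[of u a "- b"] by (simp add: tensor_minus_right)

lemma loop_bracket_add:
  "[p + p', q]\<^sub>L = [p, q]\<^sub>L + [p', q]\<^sub>L"
  "[p, q + q']\<^sub>L = [p, q]\<^sub>L + [p, q']\<^sub>L"
  using loop_bracket_diff(1)[of "p + p'" p' q] loop_bracket_diff(2)[of p "q + q'" q']
  by (simp_all add: eq_diff_eq)

lemma loop_act_add: "(p + q) \<cdot> b = p \<cdot> b + q \<cdot> b"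
  using loop_act_diff[of "p + q" q b] by simp

lemma equitable_add: "equitable a b c + equitable a' b' c' = equitable (a + a') (b + b') (c + c')"
  by (simp add: equitable_def tensor_add_right algebra_simps)

lemma equitable_diff: "equitable a b c - equitable a' b' c' = equitable (a - a') (b - b') (c - c')"
  by (simp add: equitable_def tensor_diff_right algebra_simps)

lemma equitable_scale:
  "k *\<^sub>L equitable a b c
    = equitable (three_point_const k * a) (three_point_const k * b) (three_point_const k * c)"
  by (simp add: equitable_def loop_scale_add tensor_scale_right[symmetric] three_point_scale_def)

lemma equitable_act: "equitable a b c \<cdot> r = equitable (a * r) (b * r) (c * r)"
  by (simp add: equitable_def loop_act_add loop_act_tensor)

text \<open>Each of the pairs (x,y), (y,z), (z,x) brackets to twice the sum of its members, so its
  2x2 minor, doubled to \<open>P\<close>, enters both corresponding coordinates. The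
  \<open>P\<close> terms follow the cyclic order of the pairs.\<close>

lemma equitable_bracket:
  fixes a b c :: "'a::field three_point"
  defines "P \<equiv> \<lambda>a b a' b'. 2 * (a * b' - b * a')"
  shows "[equitable a b c, equitable a' b' c']\<^sub>L
    = equitable (P a b a' b' + P c a c' a') (P a b a' b' + P b c b' c') (P b c b' c' + P c a c' a')"
proof -
  have two: "sl2_scale 2 u \<otimes> r = u \<otimes> (2 * r)" for u :: "'a sl2" and r
    by (simp add: tensor_scale_left tensor_scale_right[symmetric] three_point_scale_def
        three_point_const_2)
  have anti: "sl2_bracket sl2_y sl2_x = - sl2_bracket sl2_x (sl2_y :: 'a sl2)"
    "sl2_bracket sl2_z sl2_y = - sl2_bracket sl2_y (sl2_z :: 'a sl2)"
    "sl2_bracket sl2_x sl2_z = - sl2_bracket sl2_z (sl2_x :: 'a sl2)"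
    by (rule sl2_bracket_antisym)+
  show ?thesis
    unfolding equitable_def P_def loop_bracket_add loop_bracket_tensor sl2_bracket_self anti
      tensor_zero_left tensor_minus_left sl2_equitable_brackets tensor_add_left two
    by (simp add: tensor_add_right tensor_diff_right algebra_simps)
qed


subsection \<open>The Onsager Lie algebra\<close>

text \<open>By bilinearity the closure condition extends from generators to the span, first in the
  right argument and then in the left one.\<close>

lemma lie_subalgebra_span:
  assumes "\<And>p q. p \<in> X \<Longrightarrow> q \<in> X \<Longrightarrow> [p, q]\<^sub>L \<in> loop.span X"
  shows "lie_subalgebra (loop.span X)"
proof -
  have right: "[p, q]\<^sub>L \<in> loop.span X" if "p \<in> X" "q \<in> loop.span X" for p q
    using that(2)
    by (induction rule: loop.span_induct_alt)
      (auto simp: loop_bracket_zero loop_bracket_add loop_bracket_scale loop.span_zero assms that(1)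
        intro!: loop.span_add loop.span_scale)
  have "[p, q]\<^sub>L \<in> loop.span X" if "p \<in> loop.span X" "q \<in> loop.span X" for p q
    using that(1)
    by (induction rule: loop.span_induct_alt)
      (auto simp: loop_bracket_zero loop_bracket_add loop_bracket_scale loop.span_zero right that(2)
        intro!: loop.span_add loop.span_scale)
  then show ?thesis
    by (simp add: lie_subalgebra_def)
qed

lemma lie_subalgebra_Inter: "(\<And>S. S \<in> \<S> \<Longrightarrow> lie_subalgebra S) \<Longrightarrow> lie_subalgebra (\<Inter>\<S>)"
  unfolding lie_subalgebra_def loop.subspace_def by blast

lemma lie_subalgebra_onsager: "lie_subalgebra onsager"
  unfolding onsager_def by (rule hull_in, rule lie_subalgebra_Inter) blast

theorem theorem9p3:
  fixes A B \<psi> :: "nat \<Rightarrow> 'a::field_char_0 loop"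
  assumes A_def: "\<And>i. A i = sl2_x \<otimes> (- t) ^ i"
    and B_def: "\<And>i. B i = (- (sl2_y \<otimes> t) - sl2_z \<otimes> (t - 1)) \<cdot> (- t) ^ i"
    and \<psi>_def: "\<And>i. \<psi> i = (sl2_x \<otimes> 1 - sl2_z \<otimes> (t - 1)) \<cdot> (- t) powi (int i - 1)"
  shows "basis_family (case_sum A (case_sum B (\<lambda>i. \<psi> (i + 1))) :: nat + nat + nat \<Rightarrow> 'a loop) onsager
    \<and> A 0 = onsager_A \<and> B 0 = - onsager_B
    \<and> (\<forall>i j. [A i, A j]\<^sub>L = 0
         \<and> [B i, B j]\<^sub>L = 0
         \<and> [\<psi> i, \<psi> j]\<^sub>L = 0
         \<and> [\<psi> i, A j]\<^sub>L = 2 *\<^sub>L \<psi> (i + j) + 2 *\<^sub>L A (i + j)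
         \<and> [B i, \<psi> j]\<^sub>L = 2 *\<^sub>L B (i + j) + 2 *\<^sub>L \<psi> (i + j)
         \<and> [A i, B j]\<^sub>L = 2 *\<^sub>L A (i + j) + 2 *\<^sub>L B (i + j) - 4 *\<^sub>L \<psi> (i + j + 1))"
proof -

  \<comment> \<open>Equitable coordinates of the three families\<close>
  define T :: "'a three_point" where "T = - t"
  \<comment> \<open>\<open>q 0\<close> is the inverse of \<open>T\<close>, needed for
    \<open>\<psi> 0\<close>; all other \<open>q i\<close> are natural powers.\<close>
  define q :: "nat \<Rightarrow> 'a three_point" where "q i = T powi (int i - 1)" for i
  have t: "t = - T" by (simp add: T_def)
  have q: "q i * T ^ j = q (i + j)" for i j
    unfolding q_def T_def by (rule neg_t_powi_mult_power)
  have q_Suc: "q (Suc i) = T ^ i" for i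
    by (simp add: q_def)
  have q_T: "q i * T = T ^ i" for i
    using q[of i 1] q_Suc[of i] by simp
  have zero: "equitable 0 0 0 = (0 :: 'a loop)"
    by (simp add: equitable_def tensor_zero_right)
  have A: "A i = equitable (T ^ i) 0 0" for i
    by (simp add: A_def equitable_def tensor_zero_right T_def)
  have "- (sl2_y \<otimes> t) - sl2_z \<otimes> (t - 1) = equitable 0 T (T + 1 :: 'a three_point)"
    unfolding t equitable_def
    by (simp add: tensor_minus_right tensor_diff_right tensor_add_right tensor_zero_right)
  then have B: "B i = equitable 0 (T * T ^ i) ((T + 1) * T ^ i)" for i
    by (simp add: B_def equitable_act T_def)
  have "sl2_x \<otimes> 1 - sl2_z \<otimes> (t - 1) = equitable 1 0 (T + 1 :: 'a three_point)"
    unfolding t equitable_def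
    by (simp add: tensor_minus_right tensor_diff_right tensor_add_right tensor_zero_right)
  then have \<psi>: "\<psi> i = equitable (q i) 0 ((T + 1) * q i)" for i
    by (simp add: \<psi>_def equitable_act T_def q_def)
  have const4: "three_point_const 4 = (4 :: 'a three_point)"
    using three_point_const_hom(3)[of 2 "2 :: 'a"] by (simp add: three_point_const_2)
  note const = three_point_const_2 const4

  \<comment> \<open>Bracket relations\<close>
  have AA: "[A i, A j]\<^sub>L = 0" for i j
    by (simp add: A equitable_bracket zero)
  have BB: "[B i, B j]\<^sub>L = 0" for i j
    by (simp add: B equitable_bracket zero[symmetric] algebra_simps)
  have \<psi>\<psi>: "[\<psi> i, \<psi> j]\<^sub>L = 0" for i j
    by (simp add: \<psi> equitable_bracket zero[symmetric] algebra_simps)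
  \<comment> \<open>Since \<open>i\<close> may be 0, the powers are expressed through
    \<open>q i\<close> and \<open>T ^ j\<close>. What remains are polynomial identities, without any
    explicit inverse of \<open>T\<close>.\<close>
  have \<psi>A: "[\<psi> i, A j]\<^sub>L = 2 *\<^sub>L \<psi> (i + j) + 2 *\<^sub>L A (i + j)" for i j
    by (simp add: A \<psi> equitable_bracket equitable_add equitable_scale const
        q[symmetric] q_T[symmetric, of i] power_add algebra_simps)
  have B\<psi>: "[B i, \<psi> j]\<^sub>L = 2 *\<^sub>L B (i + j) + 2 *\<^sub>L \<psi> (i + j)" for i j
  proof -
    have *: "q (i + j) = T ^ i * q j" "T ^ (i + j) = T ^ i * (q j * T)"
      by (simp_all add: q q_T power_add add.commute mult.commute[of "T ^ i"])
    show ?thesis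
      unfolding B \<psi> * equitable_bracket equitable_add equitable_scale const
      by (simp add: algebra_simps)
  qed
  have AB: "[A i, B j]\<^sub>L = 2 *\<^sub>L A (i + j) + 2 *\<^sub>L B (i + j) - 4 *\<^sub>L \<psi> (i + j + 1)" for i j
    by (simp add: A B \<psi> equitable_bracket equitable_add equitable_diff equitable_scale const
        q_Suc power_add algebra_simps)

  have A0: "A 0 = onsager_A"
    by (simp add: A_def onsager_A_def)
  have B0: "B 0 = - onsager_B"
    by (simp add: B_def onsager_B_def loop_act_diff loop_act_tensor tensor_minus_left[symmetric])

  \<comment> \<open>Linear independence\<close>
  let ?b = "case_sum A (case_sum B (\<lambda>i. \<psi> (i + 1))) :: nat + nat + nat \<Rightarrow> 'a loop"

  have independent: "inj ?b" "loop.independent (range ?b)"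
  proof -
    \<comment> \<open>These are the denominators in the dual basis; 2 is invertible because the
      characteristic is zero.\<close>
    define half r d :: "'a three_point" where
      "half = three_point_const (1 / 2)" and "r = inverse t" and "d = inverse (t - 1)"
    have half: "half * (2 * a) = a" "half * (r * (2 * a)) = r * a" for a
      using unit_cancel_left[OF three_point_const_half[where 'a = 'a]]
      by (simp_all add: half_def mult.left_commute[of r])
    have r: "T * (r * a) = - a" for a
      using unit_cancel_left[OF three_point_units(1), of a]
      by (simp add: r_def T_def mult.left_commute[of t "inverse t"])
    moreover have "T * (d * (r * a)) = d * (T * (r * a))" for a
      by (rule mult.left_commute)
    ultimately have r': "T * (d * (r * a)) = - (d * a)" for a
      by simp
    \<comment> \<open>With \<open>T = - t\<close> this is t/(t-1) = 1 + 1/(t-1), multiplied by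
      -(T^i).\<close>
    have d: "T * (d * T ^ i) = - (T ^ i) - d * T ^ i" for i
    proof -
      have "(t - 1) * d * T ^ i = T ^ i"
        using three_point_units(2)[where ?'b = 'a] by (simp add: d_def)
      then show ?thesis
        by (simp add: T_def algebra_simps)
    qed
    \<comment> \<open>With values \<open>a\<close>, \<open>b\<close>, \<open>c\<close> at e, f, h,
      the functional takes the values \<open>2 * a - c\<close>, \<open>- 2 * b - c\<close>,
      \<open>c\<close> at x, y, z. Prescribing 0 or 1 at \<open>A 0\<close>, \<open>B 0\<close>,
      \<open>\<psi> 1\<close> gives linear equations for each triple.\<close>
    have functional: "loop_functional (Sl2 a b c) (equitable a' b' c')
        = 2 * (a * a') - c * a' - 2 * (b * b') - c * b' + c * c'" for a b c a' b' c' :: "'a three_point"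
      by (simp add: equitable_def loop_functional_add loop_functional_tensor tensor_functional_def
          sl2_ops three_point_const_hom three_point_const_2 three_point_const_minus algebra_simps)
    \<comment> \<open>The dual basis of \<open>A 0\<close>, \<open>B 0\<close>, \<open>\<psi> 1\<close>.\<close>
    define fA fB f\<psi> where
      "fA = Sl2 (half * (1 + d)) (- (half * (r * d))) d"
      and "fB = Sl2 0 (half * r) 0"
      and "f\<psi> = Sl2 (- (half * d)) (half * (r * d)) (- d)"
    have dual:
      "loop_functional fA (A i) = T ^ i" "loop_functional fA (B i) = 0"
      "loop_functional fA (\<psi> (Suc i)) = 0"
      "loop_functional fB (A i) = 0" "loop_functional fB (B i) = T ^ i"
      "loop_functional fB (\<psi> (Suc i)) = 0"
      "loop_functional f\<psi> (A i) = 0" "loop_functional f\<psi> (B i) = 0"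
      "loop_functional f\<psi> (\<psi> (Suc i)) = T ^ i" for i
      by (simp_all add: fA_def fB_def f\<psi>_def A B \<psi> q_Suc functional half r r' d algebra_simps)
    \<comment> \<open>\<open>k\<close> embeds the indices of one family and \<open>w\<close> is its
      dual functional. Applying \<open>w\<close> to the relation erases the other two families and
      leaves a relation between distinct powers of \<open>- t\<close>; \<open>inv k\<close> recovers
      the exponents.\<close>
    have coeff_zero: "u (k i) = 0"
      if S: "finite S" "(\<Sum>s\<in>S. u s *\<^sub>L ?b s) = 0" "k i \<in> S"
        and k: "inj k" "\<And>i. loop_functional w (?b (k i)) = T ^ i"
        and zero: "\<And>s. s \<notin> range k \<Longrightarrow> loop_functional w (?b s) = 0"
      for S and u :: "nat + nat + nat \<Rightarrow> 'a" and k :: "nat \<Rightarrow> nat + nat + nat" and i w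
    proof -
      have "0 = loop_functional w (\<Sum>s\<in>S. u s *\<^sub>L ?b s)"
        using S(2) by (simp add: loop_functional_zero)
      also have "\<dots> = (\<Sum>s\<in>S. three_point_const (u s) * loop_functional w (?b s))"
        by (simp add: loop_functional_sum loop_functional_scale)
      also have "\<dots> = (\<Sum>s\<in>S \<inter> range k. three_point_const (u s) * loop_functional w (?b s))"
        using S(1) zero by (intro sum.mono_neutral_right) auto
      also have "\<dots> = (\<Sum>s\<in>S \<inter> range k. three_point_const (u s) * (- t) ^ inv k s)"
        using k by (intro sum.cong) (auto simp: T_def)
      finally show ?thesis
        using neg_t_powers_independent[of "S \<inter> range k" "inv k" u "k i"] S(1,3)
        by (auto simp: inj_on_inv_into)
    qed
    have fA: "loop_functional fA (?b s) = 0" if "s \<notin> range Inl" for s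
      using that by (auto simp: dual split: sum.splits)
    have fB: "loop_functional fB (?b s) = 0" if "s \<notin> range (Inr \<circ> Inl)" for s
      using that by (auto simp: dual image_iff split: sum.splits)
    have f\<psi>: "loop_functional f\<psi> (?b s) = 0" if "s \<notin> range (Inr \<circ> Inr)" for s
      using that by (auto simp: dual image_iff split: sum.splits)
    have coeffs_zero: "u s = 0" if S: "finite S" "(\<Sum>s\<in>S. u s *\<^sub>L ?b s) = 0" "s \<in> S" for S u s
    proof -
      consider i where "s = Inl i" | i where "s = Inr (Inl i)" | i where "s = Inr (Inr i)"
        by (metis sum.exhaust)
      then show ?thesis
      proof cases
        case 1
        then show ?thesis
          using coeff_zero[OF S(1,2), of Inl i fA] S(3) fA by (simp add: dual)
      next
        case 2
        then show ?thesis
          using coeff_zero[OF S(1,2), of "Inr \<circ> Inl" i fB] S(3) fB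
          by (simp add: dual inj_compose)
      next
        case 3
        then show ?thesis
          using coeff_zero[OF S(1,2), of "Inr \<circ> Inr" i f\<psi>] S(3) f\<psi>
          by (simp add: dual inj_compose)
      qed
    qed
    show "inj ?b" "loop.independent (range ?b)"
      by (rule loop.independent_familyI, erule (2) coeffs_zero)+
  qed

  \<comment> \<open>The span is the Onsager Lie algebra\<close>
  have span_eq: "loop.span (range ?b) = onsager"
  proof
    have base: "A i \<in> loop.span (range ?b)" "B i \<in> loop.span (range ?b)"
      "\<psi> (Suc i) \<in> loop.span (range ?b)" for i
      using rangeI[of ?b "Inl i"] rangeI[of ?b "Inr (Inl i)"] rangeI[of ?b "Inr (Inr i)"]
      by (auto intro!: loop.span_base)
    note closed = loop.span_add loop.span_diff loop.span_scale loop.span_neg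
    have "lie_subalgebra (loop.span (range ?b))"
    proof (rule lie_subalgebra_span, elim rangeE, hypsubst)
      have AB': "[A i, B j]\<^sub>L \<in> loop.span (range ?b)" for i j
        unfolding AB using base by (simp add: closed)
      \<comment> \<open>As the index of \<psi> on the left is positive, so is the one on the right;
        \<open>\<psi> 0\<close>, which is not in the family, never appears.\<close>
      have \<psi>A': "[\<psi> (Suc i), A j]\<^sub>L \<in> loop.span (range ?b)" for i j
        unfolding \<psi>A using base by (simp add: closed)
      have B\<psi>': "[B i, \<psi> (Suc j)]\<^sub>L \<in> loop.span (range ?b)" for i j
        unfolding B\<psi> using base by (simp add: closed)
      have flip: "[q, p]\<^sub>L \<in> loop.span (range ?b)" if "[p, q]\<^sub>L \<in> loop.span (range ?b)" for p q
        using loop.span_neg[OF that] by (simp add: loop_bracket_antisym[of q p])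
      show "[?b i, ?b j]\<^sub>L \<in> loop.span (range ?b)" for i j
        using AB' \<psi>A' B\<psi>' AB'[THEN flip] \<psi>A'[THEN flip] B\<psi>'[THEN flip]
        by (simp add: AA BB \<psi>\<psi> loop.span_zero split: sum.split)
    qed
    moreover have "onsager_A \<in> loop.span (range ?b)" "onsager_B \<in> loop.span (range ?b)"
      using base(1)[of 0] loop.span_neg[OF base(2)[of 0]] by (simp_all add: A0 B0)
    ultimately show "onsager \<subseteq> loop.span (range ?b)"
      unfolding onsager_def by (intro hull_minimal) simp_all
  next
    have sub: "loop.subspace (onsager :: 'a loop set)"
      and br: "p \<in> onsager \<Longrightarrow> q \<in> onsager \<Longrightarrow> [p, q]\<^sub>L \<in> onsager" for p q :: "'a loop"
      using lie_subalgebra_onsager by (auto simp: lie_subalgebra_def)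
    note closed = loop.subspace_add[OF sub] loop.subspace_diff[OF sub]
      loop.subspace_scale[OF sub] loop.subspace_neg[OF sub]
    \<comment> \<open>Membership of the multiples by 2 and 4 obtained from brackets passes to the
      elements themselves, as 2 and 4 are nonzero in characteristic zero.\<close>
    have unscale: "p \<in> onsager" if "c *\<^sub>L p \<in> onsager" "c \<noteq> 0" for p :: "'a loop" and c
      using loop.subspace_scale[OF sub that(1), of "inverse c"] that(2) by simp
    have gen: "onsager_A \<in> (onsager :: 'a loop set)" "onsager_B \<in> (onsager :: 'a loop set)"
      unfolding onsager_def by (rule hull_inc; simp)+
    have mem: "A i \<in> onsager \<and> B i \<in> onsager \<and> \<psi> (Suc i) \<in> onsager" for i
    proof -
      have \<psi>_mem: "\<psi> (Suc i) \<in> onsager" if "A i \<in> onsager" "B i \<in> onsager" "A 0 \<in> onsager" for i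
      proof -
        have "4 *\<^sub>L \<psi> (Suc i) = 2 *\<^sub>L A i + 2 *\<^sub>L B i - [A 0, B i]\<^sub>L"
          by (simp add: AB)
        then have "4 *\<^sub>L \<psi> (Suc i) \<in> onsager"
          using that by (simp add: closed br)
        then show ?thesis
          by (rule unscale) simp
      qed
      show ?thesis
      proof (induction i)
        case 0
        then show ?case
          using gen \<psi>_mem[of 0] by (simp add: A0 B0 closed)
      next
        case (Suc i)
        have A0_mem: "A 0 \<in> onsager" and B0_mem: "B 0 \<in> onsager"
          using gen by (simp_all add: A0 B0 closed)
        have \<psi>1: "\<psi> 1 \<in> onsager"
          using \<psi>_mem[OF A0_mem B0_mem A0_mem] by simp
        \<comment> \<open>The relations are solved for the new elements. The term
          \<open>\<psi> (Suc i)\<close> to be subtracted is available from the induction hypothesis,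
          which is why \<open>mem\<close> treats it together with \<open>A i\<close> and
          \<open>B i\<close>.\<close>
        have "2 *\<^sub>L A (Suc i) = [\<psi> 1, A i]\<^sub>L - 2 *\<^sub>L \<psi> (Suc i)"
          "2 *\<^sub>L B (Suc i) = [B i, \<psi> 1]\<^sub>L - 2 *\<^sub>L \<psi> (Suc i)"
          by (simp_all add: \<psi>A B\<psi>)
        then have "2 *\<^sub>L A (Suc i) \<in> onsager" "2 *\<^sub>L B (Suc i) \<in> onsager"
          using Suc \<psi>1 by (simp_all add: closed br)
        then have "A (Suc i) \<in> onsager" "B (Suc i) \<in> onsager"
          by (simp_all add: unscale[of 2])
        then show ?case
          using \<psi>_mem A0_mem by blast
      qed
    qed
    have "range ?b \<subseteq> onsager"
      using mem by (auto split: sum.splits)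
    then show "loop.span (range ?b) \<subseteq> onsager"
      using sub by (rule loop.span_minimal)
  qed

  show ?thesis
    unfolding basis_family_def
    using independent span_eq A0 B0 AA BB \<psi>\<psi> \<psi>A B\<psi> AB by blast
qed

end
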